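(* Let $n\ge 1$ be an integer and let $F_{n+1}$ be the fan graph on $n+1$ vertices. Then $$\mathcal{L}(F_{n+1})=n!+\sum_{k=0}^{n-1}(n-k)!\,2^{k}.$$
   Context: Let $H$ be a finite, connected, undirected graph with vertex set $V$. A random walk labeling of $H$ is a labeling of $V$ obtainable by the following process: (1) set $i=1$, choose any $v\in V$ and label $v$ with $i$; (2) as long as there are unlabeled vertices, choose a vertex $w$ adjacent to the current vertex $v$ and replace $v$ by $w$; if this new $v$ is not labeled, increase $i$ by $1$ and label $v$ with $i$. The number of different random walk labelings of $H$ is denoted by $\mathcal{L}(H)$. The fan graph $F_{n+1}$ is formed by adding one new vertex to the path graph $P_n$ on $n$ vertices and connecting it to all the vertices of $P_n$. *)

theory Defs
  imports Complex_Main "Graph_Theory.Graph_Theory"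
begin

text \<open>Undirected graphs are symmetric digraphs without parallel arcs, i.e. \<open>pair_graph\<close>
  in \<open>Graph_Theory\<close>.\<close>

definition path_graph :: "nat \<Rightarrow> nat pair_pre_digraph" where
  "path_graph n = \<lparr> pverts = {1..n},
     parcs = {(u, v). u \<in> {1..n} \<and> v \<in> {1..n} \<and> (v = u + 1 \<or> u = v + 1)} \<rparr>"

text \<open>The new vertex is \<open>None\<close>.\<close>

definition add_apex :: "'a pair_pre_digraph \<Rightarrow> 'a option pair_pre_digraph" where
  "add_apex G = \<lparr> pverts = insert None (Some ` pverts G),
     parcs = {(Some u, Some v) | u v. (u, v) \<in> parcs G}
       \<union> {(None, Some v) | v. v \<in> pverts G} \<union> {(Some v, None) | v. v \<in> pverts G} \<rparr>"

text \<open>The index counts all vertices, so \<open>fan_graph (n + 1)\<close> is built on the path with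
  \<open>n\<close> vertices.\<close>

definition fan_graph :: "nat \<Rightarrow> nat option pair_pre_digraph" where
  "fan_graph m = add_apex (path_graph (m - 1))"

text \<open>A state of the labeling process consists of the current vertex, the partial labeling
  constructed so far, and the counter.\<close>

inductive rw_state :: "'a pair_pre_digraph \<Rightarrow> 'a \<Rightarrow> ('a \<rightharpoonup> nat) \<Rightarrow> nat \<Rightarrow> bool"
  for G :: "'a pair_pre_digraph" where
  start: "v \<in> pverts G \<Longrightarrow> rw_state G v [v \<mapsto> 1] 1"
| old: "\<lbrakk>rw_state G v l i; dom l \<noteq> pverts G; (v, w) \<in> parcs G; w \<in> dom l\<rbrakk>
    \<Longrightarrow> rw_state G w l i"
| new: "\<lbrakk>rw_state G v l i; dom l \<noteq> pverts G; (v, w) \<in> parcs G; w \<notin> dom l\<rbrakk>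
    \<Longrightarrow> rw_state G w (l(w \<mapsto> i + 1)) (i + 1)"

definition rw_labelings :: "'a pair_pre_digraph \<Rightarrow> ('a \<rightharpoonup> nat) set" where
  "rw_labelings G = {l. dom l = pverts G \<and> (\<exists>v i. rw_state G v l i)}"

definition num_rw_labelings :: "'a pair_pre_digraph \<Rightarrow> nat" where
  "num_rw_labelings G = card (rw_labelings G)"

lemma pair_graph_fan_graph: "pair_graph (fan_graph m)"
proof -
  have f: "finite (pverts (fan_graph m))"
    by (simp add: fan_graph_def add_apex_def path_graph_def)
  have s: "parcs (fan_graph m) \<subseteq> pverts (fan_graph m) \<times> pverts (fan_graph m)"
    by (auto simp: fan_graph_def add_apex_def path_graph_def)
  have "finite (parcs (fan_graph m))"
    using finite_subset[OF s] f by blast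
  moreover have "symmetric (with_proj (fan_graph m))"
    by (auto simp: symmetric_def sym_def fan_graph_def add_apex_def path_graph_def)
  moreover have "fst e \<noteq> snd e" if "e \<in> parcs (fan_graph m)" for e
    using that by (auto simp: fan_graph_def add_apex_def path_graph_def)
  ultimately show ?thesis
    using f s by unfold_locales auto
qed

lemma connected_fan_graph: "connected (with_proj (fan_graph m))"
proof -
  interpret pair_graph "fan_graph m" by (rule pair_graph_fan_graph)
  let ?R = "\<lambda>u v. u \<rightarrow>\<^sup>*\<^bsub>with_proj (fan_graph m)\<^esub> v"
  have 0: "None \<in> pverts (fan_graph m)"
    by (simp add: fan_graph_def add_apex_def)
  have a: "(None, u) \<in> parcs (fan_graph m) \<and> (u, None) \<in> parcs (fan_graph m)"
    if "u \<in> pverts (fan_graph m)" "u \<noteq> None" for u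
    using that by (auto simp: fan_graph_def add_apex_def path_graph_def)
  have r: "?R None u \<and> ?R u None" if "u \<in> pverts (fan_graph m)" for u
    using a[OF that] 0 reachable_adjI[of None u] reachable_adjI[of u None] that
    by (cases "u = None") auto
  have "?R u v" if "u \<in> pverts (fan_graph m)" "v \<in> pverts (fan_graph m)" for u v
    using reachable_trans[of u None v] r that by blast
  then show ?thesis
    using 0 reachable_mk_symmetricI
    by (auto simp: connected_def strongly_connected_def)
qed

end

theory Submission
  imports Defs
begin

text \<open>A walk may wander freely inside the labeled vertices, so the random walk labelings are exactly
  the vertex orderings all of whose nonempty prefixes induce a connected subgraph. In the fan such
  an ordering starts with \<open>k\<close> path vertices, then visits the apex, then the other \<open>n - k\<close> vertices
  in any order. For \<open>k \<ge> 1\<close> the first \<open>k\<close> vertices form one of \<open>n - k + 1\<close> intervals, each of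
  which is built up in \<open>2 ^ (k - 1)\<close> ways, as its last vertex is one of its two ends.\<close>

section \<open>Labelings as connected orderings\<close>

text \<open>The list is in reverse order: its head is the vertex labeled last.\<close>

primrec conn_order :: "'a pair_pre_digraph \<Rightarrow> 'a list \<Rightarrow> bool" where
  "conn_order G [] = True"
| "conn_order G (w # xs) \<longleftrightarrow> conn_order G xs \<and> w \<in> pverts G \<and> w \<notin> set xs
     \<and> (xs = [] \<or> (\<exists>u\<in>set xs. (u, w) \<in> parcs G))"

primrec labeling_of :: "'a list \<Rightarrow> ('a \<rightharpoonup> nat)" where
  "labeling_of [] = Map.empty"
| "labeling_of (w # xs) = (labeling_of xs)(w \<mapsto> Suc (length xs))"

lemma dom_labeling_of [simp]: "dom (labeling_of xs) = set xs"
  by (induction xs) (simp_all del: fun_upd_apply)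

lemma labeling_of_le: "labeling_of xs v = Some i \<Longrightarrow> i \<le> length xs"
  by (induction xs) (auto split: if_splits)

lemma conn_order_distinct: "conn_order G xs \<Longrightarrow> distinct xs"
  by (induction xs) auto

lemma conn_order_subset: "conn_order G xs \<Longrightarrow> set xs \<subseteq> pverts G"
  by (induction xs) auto

text \<open>The domain determines the length, and the head is the one vertex whose label equals the
  length. Erasing that label leaves the labeling of the tail, so the list can be read off from its
  labeling entry by entry.\<close>

lemma labeling_of_inject:
  assumes "distinct xs" "distinct ys" "labeling_of xs = labeling_of ys"
  shows "xs = ys"
  using assms
proof (induction xs arbitrary: ys)
  case Nil
  then have "set ys = {}" by (metis dom_labeling_of set_empty)
  then show ?case by simp
next
  case (Cons x xs)
  have set_eq: "set (x # xs) = set ys" using Cons.prems(3) by (metis dom_labeling_of)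
  then have len: "length ys = Suc (length xs)"
    using Cons.prems(1,2) by (metis distinct_card length_Cons)
  then obtain y ys' where ys: "ys = y # ys'" by (cases ys) auto
  have "labeling_of ys x = Some (Suc (length xs))"
    using Cons.prems(3) by (metis fun_upd_same labeling_of.simps(2))
  \<comment> \<open>All labels coming from \<open>ys'\<close> are at most \<open>length xs\<close>,
    so the label \<open>Suc (length xs)\<close> can only sit at the head of
    \<open>ys\<close>.\<close>
  then have "x = y"
    using labeling_of_le[of ys' x] len ys by (auto split: if_splits)
  moreover have "labeling_of xs = (labeling_of (x # xs))(x := None)"
    using Cons.prems(1) dom_labeling_of[of xs] by (auto simp: fun_eq_iff domIff)
  moreover have "labeling_of ys' = (labeling_of (y # ys'))(y := None)"
    using Cons.prems(2) ys dom_labeling_of[of ys'] by (auto simp: fun_eq_iff domIff)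
  ultimately have "labeling_of xs = labeling_of ys'"
    using Cons.prems(3) ys by metis
  then show ?case using Cons ys \<open>x = y\<close> by simp
qed

text \<open>An invariant of the process: \<open>old\<close> keeps the list, \<open>new\<close> puts
  the new vertex in front. The current vertex is only required to occur in the list, since the walk
  may have returned to any earlier vertex; it is the labeled neighbour that
  \<open>conn_order\<close> demands.\<close>

lemma rw_state_conn_order:
  assumes "parcs G \<subseteq> pverts G \<times> pverts G" "rw_state G v l i"
  shows "\<exists>xs. conn_order G xs \<and> l = labeling_of xs \<and> i = length xs \<and> v \<in> set xs"
  using assms(2)
proof (induction rule: rw_state.induct)
  case (start v)
  then show ?case by (intro exI[of _ "[v]"]) auto
next
  case (old v l i w)
  then obtain xs where "conn_order G xs" "l = labeling_of xs" "i = length xs" by blast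
  then show ?case using \<open>w \<in> dom l\<close> by (intro exI[of _ xs]) simp
next
  case (new v l i w)
  then obtain xs where "conn_order G xs" "l = labeling_of xs" "i = length xs" "v \<in> set xs" by blast
  then show ?case using new assms(1) by (intro exI[of _ "w # xs"]) auto
qed

text \<open>The newest vertex \<open>w\<close> is joined to some earlier \<open>z\<close>, in both
  directions by symmetry, so paths to and from \<open>w\<close> can be routed through
  \<open>z\<close>.\<close>

lemma conn_order_connected:
  assumes "sym (parcs G)" "conn_order G xs" "u \<in> set xs" "v \<in> set xs"
  shows "(u, v) \<in> (parcs G \<inter> set xs \<times> set xs)\<^sup>*"
  using assms(2-4)
proof (induction xs arbitrary: u v)
  case Nil
  then show ?case by simp
next
  case (Cons w xs)
  let ?R = "(parcs G \<inter> set (w # xs) \<times> set (w # xs))\<^sup>*"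
  show ?case
  proof (cases "xs = []")
    case True
    then show ?thesis using Cons.prems by simp
  next
    case False
    then obtain z where z: "z \<in> set xs" "(z, w) \<in> parcs G" using Cons.prems by auto
    have "(parcs G \<inter> set xs \<times> set xs)\<^sup>* \<subseteq> ?R" by (intro rtrancl_mono) auto
    then have step: "(a, b) \<in> ?R" if "a \<in> set xs" "b \<in> set xs" for a b
      using Cons.IH Cons.prems(1) that by auto
    have "(z, w) \<in> ?R" "(w, z) \<in> ?R"
      using z assms(1) by (auto intro!: r_into_rtrancl dest: symD)
    then have "(a, z) \<in> ?R \<and> (z, a) \<in> ?R" if "a \<in> set (w # xs)" for a
      using that step z by auto
    then show ?thesis using Cons.prems by (meson rtrancl_trans)
  qed
qed

text \<open>A path inside the labeled set is a sequence of \<open>old\<close> moves, which change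
  nothing but the current vertex. Such moves are available only while some vertex is
  unlabeled.\<close>

lemma rw_state_walk:
  assumes "rw_state G v l i" "dom l \<noteq> pverts G" "(v, u) \<in> (parcs G \<inter> dom l \<times> dom l)\<^sup>*"
  shows "rw_state G u l i"
  using assms(3)
  by (induction rule: rtrancl_induct) (use assms(1,2) in \<open>auto intro: rw_state.old\<close>)

text \<open>Just after a vertex is labeled the walk stands on it, at the head of the list. Before
  labeling the next vertex it walks through labeled vertices to a neighbour of that vertex.\<close>

lemma conn_order_rw_state:
  assumes "sym (parcs G)" "conn_order G xs" "xs \<noteq> []"
  shows "rw_state G (hd xs) (labeling_of xs) (length xs)"
  using assms(2,3)
proof (induction xs)
  case Nil
  then show ?case by simp
next
  case (Cons w xs)
  show ?case
  proof (cases "xs = []")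
    case True
    then show ?thesis using Cons.prems rw_state.start[of w G] by (simp del: fun_upd_apply)
  next
    case False
    then obtain z where z: "z \<in> set xs" "(z, w) \<in> parcs G" using Cons.prems by auto
    \<comment> \<open>The vertex \<open>w\<close> is still unlabeled, so the process has not
      stopped.\<close>
    have ne: "dom (labeling_of xs) \<noteq> pverts G" using Cons.prems by auto
    have "rw_state G z (labeling_of xs) (length xs)"
      using Cons False z conn_order_connected[OF assms(1), of xs "hd xs" z]
      by (intro rw_state_walk[OF Cons.IH ne]) auto
    from rw_state.new[OF this ne z(2)] show ?thesis
      using Cons.prems(1) by (simp del: fun_upd_apply)
  qed
qed

text \<open>Entries are distinct, so having full length means listing every vertex; on these lists
  \<open>labeling_of\<close> is a bijection onto the random walk labelings.\<close>

lemma num_rw_labelings_conn_order: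
  assumes "pair_graph G" "pverts G \<noteq> {}"
  shows "num_rw_labelings G = card {xs. conn_order G xs \<and> length xs = card (pverts G)}"
proof -
  interpret pair_graph G by fact
  have sym: "sym (parcs G)" using sym_arcs by (simp add: symmetric_def)
  have wf: "parcs G \<subseteq> pverts G \<times> pverts G" using in_arcsD1 in_arcsD2 by fastforce
  let ?S = "{xs. conn_order G xs \<and> length xs = card (pverts G)}"
  have full: "length xs = card (pverts G) \<longleftrightarrow> set xs = pverts G" if "conn_order G xs" for xs
    using conn_order_distinct[OF that] conn_order_subset[OF that] finite_verts
    by (metis card_subset_eq distinct_card with_proj_simps(1))
  have "rw_labelings G = labeling_of ` ?S"
  proof (intro equalityI subsetI)
    fix l assume "l \<in> rw_labelings G"
    then obtain v i where "dom l = pverts G" "rw_state G v l i" by (auto simp: rw_labelings_def)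
    with rw_state_conn_order[OF wf] full show "l \<in> labeling_of ` ?S" by fastforce
  next
    fix l assume "l \<in> labeling_of ` ?S"
    then obtain xs where xs: "conn_order G xs" "set xs = pverts G" "l = labeling_of xs"
      using full by blast
    then have "xs \<noteq> []" using assms(2) by auto
    with xs show "l \<in> rw_labelings G"
      using conn_order_rw_state[OF sym, of xs] by (auto simp: rw_labelings_def)
  qed
  moreover have "inj_on labeling_of ?S"
    by (intro inj_onI) (auto intro: labeling_of_inject conn_order_distinct)
  ultimately show ?thesis by (simp add: num_rw_labelings_def card_image)
qed

section \<open>Adding an apex\<close>

lemma finite_conn_orders:
  assumes "finite (pverts G)"
  shows "finite {xs. conn_order G xs \<and> length xs = k \<and> P xs}"
  by (rule finite_subset[OF _ finite_lists_length_eq[OF assms, of k]])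
    (auto dest: conn_order_subset)

lemma conn_order_map_Some [simp]: "conn_order (add_apex G) (map Some xs) \<longleftrightarrow> conn_order G xs"
  by (induction xs) (auto simp: add_apex_def)

lemma card_conn_order_no_apex:
  "card {xs. conn_order (add_apex G) xs \<and> length xs = k \<and> None \<notin> set xs}
     = card {xs. conn_order G xs \<and> length xs = k}" (is "card ?A = card ?P")
proof -
  have "?A = map Some ` ?P"
  proof (intro equalityI subsetI)
    fix xs assume xs: "xs \<in> ?A"
    then have "Some (the x) = x" if "x \<in> set xs" for x using that by (cases x) auto
    then have eq: "map Some (map the xs) = xs" by (simp add: map_idI)
    then have "conn_order G (map the xs)"
      using xs conn_order_map_Some[of G "map the xs"] by auto
    then show "xs \<in> map Some ` ?P" using xs eq[symmetric] by (intro image_eqI) auto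
  qed auto
  then show ?thesis by (simp add: card_image inj_on_def)
qed

lemma card_conn_order_apex_Suc:
  assumes "finite (pverts G)"
  defines "B \<equiv> \<lambda>k. {xs. conn_order (add_apex G) xs \<and> length xs = k \<and> None \<in> set xs}"
  shows "card (B (Suc k)) = card {xs. conn_order G xs \<and> length xs = k}
           + card (B k) * (Suc (card (pverts G)) - k)"
proof -
  let ?V = "pverts (add_apex G)"
  let ?A = "{xs. conn_order (add_apex G) xs \<and> length xs = k \<and> None \<notin> set xs}"
  let ?E = "SIGMA xs:B k. ?V - set xs"
  have V: "?V = insert None (Some ` pverts G)" by (simp add: add_apex_def)
  have finV: "finite ?V" and cV: "card ?V = Suc (card (pverts G))"
    using assms(1) by (auto simp: V card_image)
  have fin: "finite ?A" "finite (B k)" unfolding B_def by (rule finite_conn_orders[OF finV])+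
  have arcs: "(None, w) \<in> parcs (add_apex G)" "(w, None) \<in> parcs (add_apex G)"
    if "w \<in> ?V" "w \<noteq> None" for w
    using that by (auto simp: add_apex_def)
  have "B (Suc k) = (#) None ` ?A \<union> (\<lambda>(xs, w). w # xs) ` ?E"
  proof (intro equalityI subsetI)
    fix ys assume "ys \<in> B (Suc k)"
    then obtain w xs where ys: "ys = w # xs" "conn_order (add_apex G) ys" "length xs = k"
        "None \<in> set ys"
      unfolding B_def by (auto simp: length_Suc_conv)
    show "ys \<in> (#) None ` ?A \<union> (\<lambda>(xs, w). w # xs) ` ?E"
    proof (cases "None \<in> set xs")
      case True
      then show ?thesis using ys by (auto simp: B_def intro!: image_eqI[of _ _ "(xs, w)"])
    next
      case False
      then show ?thesis using ys by auto
    qed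
  next
    fix ys assume "ys \<in> (#) None ` ?A \<union> (\<lambda>(xs, w). w # xs) ` ?E"
    then show "ys \<in> B (Suc k)"
    proof
      assume "ys \<in> (#) None ` ?A"
      then obtain xs where xs: "ys = None # xs" "xs \<in> ?A" by blast
      then have "\<exists>u\<in>set xs. (u, None) \<in> parcs (add_apex G)" if "xs \<noteq> []"
      proof -
        have "set xs \<subseteq> ?V" "None \<notin> set xs" using xs(2) conn_order_subset by auto
        then have "hd xs \<in> ?V" "hd xs \<noteq> None" using hd_in_set[OF that] by (blast, metis)
        with arcs(2) hd_in_set[OF that] show ?thesis by blast
      qed
      then show ?thesis using xs by (auto simp: B_def V)
    next
      assume "ys \<in> (\<lambda>(xs, w). w # xs) ` ?E"
      then obtain xs w where xs: "ys = w # xs" "xs \<in> B k" "w \<in> ?V" "w \<notin> set xs" by auto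
      then have "None \<in> set xs" by (simp add: B_def)
      then have "w \<noteq> None" using xs(4) by metis
      then show ?thesis using xs arcs(1)[of w] by (auto simp: B_def)
    qed
  qed
  moreover have "(#) None ` ?A \<inter> (\<lambda>(xs, w). w # xs) ` ?E = {}" by (auto simp: B_def)
  moreover have "card ((#) None ` ?A) = card {xs. conn_order G xs \<and> length xs = k}"
    by (simp add: card_image card_conn_order_no_apex)
  moreover have "card ((\<lambda>(xs, w). w # xs) ` ?E) = card (B k) * (Suc (card (pverts G)) - k)"
  proof -
    \<comment> \<open>An ordering in \<open>B k\<close> uses up \<open>k\<close> distinct vertices
      out of \<open>Suc (card (pverts G))\<close>.\<close>
    have "card (?V - set xs) = Suc (card (pverts G)) - k" if "xs \<in> B k" for xs
      using that conn_order_distinct[of _ xs] conn_order_subset[of _ xs] finV cV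
      by (auto simp: B_def card_Diff_subset distinct_card)
    then have "card ?E = card (B k) * (Suc (card (pverts G)) - k)"
      using fin finV by (simp add: card_SigmaI)
    then show ?thesis by (subst card_image) (auto simp: inj_on_def)
  qed
  ultimately show ?thesis using fin finV by (simp add: card_Un_disjoint)
qed

text \<open>The factorial on the left counts the ways to append the remaining vertices in any order.
  This weight turns the recurrence for the counts into a plain sum, whose index \<open>j\<close> is
  the number of vertices before the apex.\<close>

lemma card_conn_order_apex:
  assumes "finite (pverts G)" "k \<le> card (pverts G)"
  shows "card {xs. conn_order (add_apex G) xs \<and> length xs = Suc k \<and> None \<in> set xs}
           * fact (card (pverts G) - k)
         = (\<Sum>j\<le>k. card {xs. conn_order G xs \<and> length xs = j} * fact (card (pverts G) - j))"
  using assms(2)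
proof (induction k)
  case 0
  \<comment> \<open>An empty list does not contain the apex, so only the ordering that consists of
    the apex alone contributes at length 1.\<close>
  have "{xs. conn_order (add_apex G) xs \<and> length xs = 0 \<and> None \<in> set xs} = {}" by auto
  with card_conn_order_apex_Suc[OF assms(1), of 0] show ?case by simp
next
  case (Suc k)
  let ?N = "card (pverts G)"
  let ?b = "\<lambda>k. card {xs. conn_order (add_apex G) xs \<and> length xs = k \<and> None \<in> set xs}"
  let ?a = "\<lambda>k. card {xs. conn_order G xs \<and> length xs = k}"
  have "fact (?N - k) = (?N - k) * fact (?N - Suc k)"
    using Suc.prems by (metis Suc_diff_Suc Suc_le_lessD fact_Suc of_nat_id)
  then have IH: "?b (Suc k) * ((?N - k) * fact (?N - Suc k)) = (\<Sum>j\<le>k. ?a j * fact (?N - j))"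
    using Suc by simp
  have "?b (Suc (Suc k)) * fact (?N - Suc k)
      = (?a (Suc k) + ?b (Suc k) * (?N - k)) * fact (?N - Suc k)"
    using card_conn_order_apex_Suc[OF assms(1), of "Suc k"] by simp
  also have "\<dots> = ?a (Suc k) * fact (?N - Suc k) + ?b (Suc k) * ((?N - k) * fact (?N - Suc k))"
    by (simp only: distrib_right mult.assoc)
  finally show ?case unfolding IH sum.atMost_Suc by (simp only: add.commute)
qed

text \<open>A full ordering contains the apex, so this is the preceding sum at
  \<open>k = card (pverts G)\<close>, where the weight on the left is \<open>fact 0\<close>.\<close>

lemma card_conn_order_add_apex:
  assumes "finite (pverts G)"
  shows "card {xs. conn_order (add_apex G) xs \<and> length xs = card (pverts (add_apex G))}
    = (\<Sum>j\<le>card (pverts G). card {xs. conn_order G xs \<and> length xs = j}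
        * fact (card (pverts G) - j))"
proof -
  have V: "pverts (add_apex G) = insert None (Some ` pverts G)" by (simp add: add_apex_def)
  then have finV: "finite (pverts (add_apex G))"
    and cV: "card (pverts (add_apex G)) = Suc (card (pverts G))"
    using assms by (auto simp: card_image)
  have "None \<in> set xs" if "conn_order (add_apex G) xs" "length xs = card (pverts (add_apex G))" for xs
    using that conn_order_distinct[OF that(1)] conn_order_subset[OF that(1)] finV V
    by (metis card_subset_eq distinct_card insertI1)
  then have "{xs. conn_order (add_apex G) xs \<and> length xs = card (pverts (add_apex G))}
    = {xs. conn_order (add_apex G) xs \<and> length xs = Suc (card (pverts G)) \<and> None \<in> set xs}"
    using cV by auto
  then show ?thesis using card_conn_order_apex[OF assms order_refl] by simp
qed

section \<open>Connected orderings of the path\<close>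

text \<open>A path vertex outside an interval but adjacent to one of its members must extend the
  interval by one at the left or at the right.\<close>

lemma conn_order_path_interval:
  assumes "conn_order (path_graph n) xs" "length xs = Suc k"
  shows "\<exists>a\<ge>1. a + k \<le> n \<and> set xs = {a..a + k}"
  using assms
proof (induction k arbitrary: xs)
  case 0
  then show ?case by (auto simp: length_Suc_conv path_graph_def)
next
  case (Suc k)
  then obtain w ys where xs: "xs = w # ys" "length ys = Suc k" by (auto simp: length_Suc_conv)
  then obtain a where a: "a \<ge> 1" "a + k \<le> n" "set ys = {a..a + k}" using Suc by auto
  have w: "w \<ge> 1" "w \<le> n" "w \<notin> {a..a + k}" "\<exists>u\<in>{a..a + k}. w = u + 1 \<or> u = w + 1"
    using Suc.prems xs a by (auto simp: path_graph_def)
  then have "w = a + Suc k \<or> Suc w = a" by auto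
  then show ?case
  proof
    assume "w = a + Suc k"
    then show ?thesis using w a xs by (intro exI[of _ a]) auto
  next
    assume "Suc w = a"
    then show ?thesis using w a xs by (intro exI[of _ w]) auto
  qed
qed

text \<open>The last vertex is one of the two ends, since the vertices before it again form an
  interval. Each of the \<open>k\<close> enlargements of a single vertex thus doubles the
  count.\<close>

lemma card_conn_order_interval:
  assumes "1 \<le> a" "a + k \<le> n"
  shows "card {xs. conn_order (path_graph n) xs \<and> set xs = {a..a + k}} = 2 ^ k"
  using assms
proof (induction k arbitrary: a)
  case 0
  have "{xs. conn_order (path_graph n) xs \<and> set xs = {a..a + 0}} = {[a]}" (is "?L = ?R")
  proof (intro equalityI subsetI)
    fix xs assume "xs \<in> ?L"
    then have "distinct xs" "set xs = {a}" by (auto dest: conn_order_distinct)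
    then show "xs \<in> ?R" by (cases xs; cases "tl xs") auto
  next
    fix xs assume "xs \<in> ?R"
    then show "xs \<in> ?L" using 0 by (auto simp: path_graph_def)
  qed
  then show ?case by simp
next
  case (Suc k)
  let ?S = "\<lambda>a k. {xs. conn_order (path_graph n) xs \<and> set xs = {a..a + k}}"
  have "?S a (Suc k) = (#) (a + Suc k) ` ?S a k \<union> (#) a ` ?S (Suc a) k"
  proof (intro equalityI subsetI)
    fix xs assume xs: "xs \<in> ?S a (Suc k)"
    then have "length xs = Suc (Suc k)" using conn_order_distinct distinct_card by fastforce
    then obtain w ys where ys: "xs = w # ys" "length ys = Suc k" by (auto simp: length_Suc_conv)
    have wys: "insert w (set ys) = {a..a + Suc k}" "w \<notin> set ys" "conn_order (path_graph n) ys"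
      using xs ys by auto
    obtain b where b: "set ys = {b..b + k}" using conn_order_path_interval[OF wys(3) ys(2)] by blast
    \<comment> \<open>An interval of \<open>k + 1\<close> numbers inside one of \<open>k + 2\<close>
      misses exactly one end, and the missing end is \<open>w\<close>.\<close>
    have "{b..b + k} \<subseteq> {a..a + Suc k}" using wys(1) b by blast
    then have "b = a \<or> b = Suc a" by auto
    then show "xs \<in> (#) (a + Suc k) ` ?S a k \<union> (#) a ` ?S (Suc a) k"
    proof
      assume "b = a"
      moreover have "a + Suc k \<in> insert w (set ys)" using wys(1) by auto
      ultimately have "w = a + Suc k" using b by auto
      then show ?thesis using ys wys b \<open>b = a\<close> by auto
    next
      assume "b = Suc a"
      moreover have "a \<in> insert w (set ys)" using wys(1) by auto
      ultimately have "w = a" using b by auto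
      then show ?thesis using ys wys b \<open>b = Suc a\<close> by auto
    qed
  next
    fix xs assume "xs \<in> (#) (a + Suc k) ` ?S a k \<union> (#) a ` ?S (Suc a) k"
    then show "xs \<in> ?S a (Suc k)"
    proof
      assume "xs \<in> (#) (a + Suc k) ` ?S a k"
      then obtain ys where ys: "xs = (a + Suc k) # ys" "conn_order (path_graph n) ys"
        "set ys = {a..a + k}" by blast
      have "(a + k, a + Suc k) \<in> parcs (path_graph n)"
        using Suc.prems by (auto simp: path_graph_def)
      moreover have "a + Suc k \<in> pverts (path_graph n)"
        using Suc.prems by (auto simp: path_graph_def)
      moreover have "a + k \<in> set ys" "a + Suc k \<notin> set ys" using ys(3) by auto
      ultimately have "conn_order (path_graph n) xs" using ys(1,2) by auto
      moreover have "set xs = {a..a + Suc k}" using ys(1,3) by auto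
      ultimately show ?thesis by blast
    next
      assume "xs \<in> (#) a ` ?S (Suc a) k"
      then obtain ys where ys: "xs = a # ys" "conn_order (path_graph n) ys"
        "set ys = {Suc a..Suc a + k}" by blast
      have "(Suc a, a) \<in> parcs (path_graph n)" "a \<in> pverts (path_graph n)"
        using Suc.prems by (auto simp: path_graph_def)
      moreover have "Suc a \<in> set ys" "a \<notin> set ys" using ys(3) by auto
      ultimately have "conn_order (path_graph n) xs" using ys(1,2) by auto
      moreover have "set xs = {a..a + Suc k}" using ys(1,3) atLeastAtMost_insertL[of a "Suc a + k"] by simp
      ultimately show ?thesis by blast
    qed
  qed
  moreover have "(#) (a + Suc k) ` ?S a k \<inter> (#) a ` ?S (Suc a) k = {}" by auto
  moreover have "card (?S a k) = 2 ^ k" "card (?S (Suc a) k) = 2 ^ k"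
    using Suc.IH[of a] Suc.IH[of "Suc a"] Suc.prems by simp_all
  \<comment> \<open>Finiteness follows from the count itself: an infinite set has
    \<open>card\<close> 0, while a power of 2 is nonzero.\<close>
  moreover have "finite (?S a k)" "finite (?S (Suc a) k)"
    using calculation(3,4) by (metis card.infinite power_not_zero zero_neq_numeral)+
  ultimately show ?case by (simp add: card_Un_disjoint card_image)
qed

text \<open>The orderings are sorted by the interval they fill; an interval of \<open>k + 1\<close>
  vertices can start at any of \<open>1, ..., n - k\<close>.\<close>

lemma card_conn_order_path:
  assumes "k < n"
  shows "card {xs. conn_order (path_graph n) xs \<and> length xs = Suc k} = (n - k) * 2 ^ k"
proof -
  let ?S = "\<lambda>a. {xs. conn_order (path_graph n) xs \<and> set xs = {a..a + k}}"
  have eq: "{xs. conn_order (path_graph n) xs \<and> length xs = Suc k} = (\<Union>a\<in>{1..n - k}. ?S a)"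
  proof (intro equalityI subsetI)
    fix xs assume "xs \<in> {xs. conn_order (path_graph n) xs \<and> length xs = Suc k}"
    then show "xs \<in> (\<Union>a\<in>{1..n - k}. ?S a)" using conn_order_path_interval[of n xs k] by fastforce
  next
    fix xs assume "xs \<in> (\<Union>a\<in>{1..n - k}. ?S a)"
    then show "xs \<in> {xs. conn_order (path_graph n) xs \<and> length xs = Suc k}"
      using conn_order_distinct distinct_card by fastforce
  qed
  have c: "card (?S a) = 2 ^ k" if "a \<in> {1..n - k}" for a
    using that assms by (intro card_conn_order_interval) auto
  have "finite (?S a)" if "a \<in> {1..n - k}" for a
    using c[OF that] by (metis card.infinite power_not_zero zero_neq_numeral)
  moreover have "?S a \<inter> ?S b = {}" if "a \<noteq> b" for a b using that by auto
  ultimately have "card (\<Union>a\<in>{1..n - k}. ?S a) = (\<Sum>a\<in>{1..n - k}. card (?S a))"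
    by (intro card_UN_disjoint) auto
  then show ?thesis using c eq by simp
qed

section \<open>Summation over the position of the apex in the fan\<close>

theorem mainTheorem3:
  fixes n :: nat
  assumes "n \<ge> 1"
  shows "num_rw_labelings (fan_graph (n + 1)) = fact n + (\<Sum>k = 0..n - 1. fact (n - k) * 2 ^ k)"
proof -
  let ?c = "\<lambda>j. card {xs. conn_order (path_graph n) xs \<and> length xs = j}"
  have fan: "fan_graph (n + 1) = add_apex (path_graph n)" by (simp add: fan_graph_def)
  have P: "finite (pverts (path_graph n))" "card (pverts (path_graph n)) = n"
    by (simp_all add: path_graph_def)
  have "pverts (fan_graph (n + 1)) \<noteq> {}" by (simp add: fan_graph_def add_apex_def)
  from num_rw_labelings_conn_order[OF pair_graph_fan_graph this]
  have "num_rw_labelings (fan_graph (n + 1)) = (\<Sum>j\<le>n. ?c j * fact (n - j))"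
    unfolding fan card_conn_order_add_apex[OF P(1)] P(2) .
  \<comment> \<open>The term \<open>j = 0\<close>, where the apex comes first, is split off: it
    yields the separate \<open>fact n\<close>, and the interval count applies only to nonempty
    orderings.\<close>
  also have "\<dots> = ?c 0 * fact n + (\<Sum>j<n. ?c (Suc j) * fact (n - Suc j))"
    by (subst sum.atMost_shift) simp
  also have "{xs. conn_order (path_graph n) xs \<and> length xs = 0} = {[]}" by auto
  also have "(\<Sum>j<n. ?c (Suc j) * fact (n - Suc j)) = (\<Sum>j<n. fact (n - j) * 2 ^ j)"
  proof (intro sum.cong refl)
    fix j assume "j \<in> {..<n}"
    then have "j < n" by simp
    \<comment> \<open>The number \<open>n - j\<close> of intervals is absorbed into the factorial of
      the vertices left after the apex.\<close>
    then have "fact (n - j) = (n - j) * fact (n - Suc j)"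
      by (metis Suc_diff_Suc fact_Suc of_nat_id)
    then show "?c (Suc j) * fact (n - Suc j) = fact (n - j) * 2 ^ j"
      using card_conn_order_path[OF \<open>j < n\<close>] by simp
  qed
  \<comment> \<open>This needs \<open>n \<ge> 1\<close>: with truncated subtraction the right side
    would be \<open>{0}\<close> for \<open>n = 0\<close>.\<close>
  also have "{..<n} = {0..n - 1}" using assms by auto
  finally show ?thesis by simp
qed

end
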